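(* $\left[\int bv\right]^{\alpha}=d(\ell_{1})$.
   Context: All sequences are complex sequences $x=(x_k)_{k\ge 1}$; $\omega$ is the space of all of them. Define $\int bv=\{x\in\omega:\sum_{k\ge1}|k x_k-(k-1)x_{k-1}|<\infty\}$, where the term for $k=1$ is $|x_1|$, and $d(\ell_1)=\{x\in\omega:\sum_{k\ge1}|k^{-1}x_k|<\infty\}$. For $X\subset\omega$, the $\alpha$-dual is $X^{\alpha}=\{a\in\omega:\sum_{k}|a_kx_k|<\infty\text{ for all }x\in X\}$. *)

theory Defs
  imports "HOL-Analysis.Infinite_Sum"
begin

text \<open>
  Sequences are indexed by the integers \<open>k \<ge> 1\<close>. We keep these indices literally and represent
  \<open>(x\<^sub>k)\<^sub>k\<^sub>\<ge>\<^sub>1\<close> by a function on \<^typ>\<open>nat\<close> whose unused coordinate at \<open>0\<close> is normalised to \<open>0\<close>,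
  so that every sequence has exactly one representative.
\<close>

definition omega :: "(nat \<Rightarrow> complex) set" where
  "omega = {x. x 0 = 0}"

text \<open>
  All series below have nonnegative real terms, for which unordered summability over \<open>{1..}\<close>
  is the same as convergence of the partial sums.
\<close>

text \<open>The term for \<open>k = 1\<close> is \<open>\<bar>x\<^sub>1\<bar>\<close>, because the factor \<open>k - 1\<close> vanishes there.\<close>

definition int_bv :: "(nat \<Rightarrow> complex) set" where
  "int_bv = {x \<in> omega.
     (\<lambda>k. cmod (of_nat k * x k - of_nat (k - 1) * x (k - 1))) summable_on {1..}}"

definition d_l1 :: "(nat \<Rightarrow> complex) set" where
  "d_l1 = {x \<in> omega. (\<lambda>k. cmod (inverse (of_nat k) * x k)) summable_on {1..}}"

definition alpha_dual :: "(nat \<Rightarrow> complex) set \<Rightarrow> (nat \<Rightarrow> complex) set" where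
  "alpha_dual X = {a \<in> omega. \<forall>x\<in>X. (\<lambda>k. cmod (a k * x k)) summable_on {1..}}"

end

theory Submission
  imports Defs
begin

text \<open>
  Telescoping bounds \<open>\<bar>k x\<^sub>k\<bar>\<close> by the \<open>\<integral>bv\<close>-norm of \<open>x\<close>, which gives \<open>d(\<ell>\<^sub>1) \<subseteq> [\<integral>bv]\<^sup>\<alpha>\<close>.
  The reverse inclusion is tested on the single sequence \<open>x\<^sub>k = 1/k\<close>.
\<close>

lemma int_bv_bounded:
  assumes "x \<in> int_bv"
  obtains M where "\<And>n. cmod (of_nat n * x n) \<le> M"
proof
  define D where "D k = cmod (of_nat k * x k - of_nat (k - 1) * x (k - 1))" for k
  have D: "D summable_on {1..}"
    using assms unfolding int_bv_def D_def by auto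
  fix n
  \<comment> \<open>The sequence \<open>k * x k\<close> starts from 0 at \<open>k = 0\<close>, so
    its value at \<open>n\<close> is the sum of its first \<open>n\<close> increments.\<close>
  have "cmod (of_nat n * x n) \<le> (\<Sum>k\<in>{1..n}. D k)"
  proof (induction n)
    case 0
    then show ?case by simp
  next
    case (Suc n)
    have "cmod (of_nat (Suc n) * x (Suc n)) \<le> D (Suc n) + cmod (of_nat n * x n)"
      unfolding D_def diff_Suc_1 by (metis add.commute norm_triangle_sub)
    with Suc show ?case by simp
  qed
  also have "\<dots> \<le> infsum D {1..}"
    by (rule finite_sum_le_infsum[OF D]) (auto simp: D_def)
  finally show "cmod (of_nat n * x n) \<le> infsum D {1..}" .
qed

text \<open>Here \<open>k * x k\<close> is 1 for every \<open>k \<ge> 1\<close>, so the only nonzero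
  difference is the one at \<open>k = 1\<close>. The convention \<open>inverse 0 = 0\<close> gives
  the normalisation at 0 that \<open>omega\<close> demands.\<close>

lemma inverse_of_nat_in_int_bv: "(\<lambda>k. inverse (of_nat k)) \<in> int_bv"
proof -
  let ?D = "\<lambda>k. cmod (of_nat k * inverse (of_nat k) - of_nat (k - 1) * inverse (of_nat (k - 1)))"
  have "?D summable_on {1} \<longleftrightarrow> ?D summable_on {1..}"
    by (rule summable_on_cong_neutral) auto
  then show ?thesis
    by (simp add: int_bv_def omega_def)
qed

theorem theorem3p4:
  "alpha_dual int_bv = d_l1"
proof (intro equalityI subsetI)
  fix a assume "a \<in> alpha_dual int_bv"
  then show "a \<in> d_l1"
    \<comment> \<open>For this test sequence the dual condition is, up to commuting the factors, the
      series that defines \<open>d_l1\<close>.\<close>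
    using inverse_of_nat_in_int_bv by (auto simp: alpha_dual_def d_l1_def mult.commute)
next
  fix a assume "a \<in> d_l1"
  then have a: "a \<in> omega" "(\<lambda>k. cmod (inverse (of_nat k) * a k)) summable_on {1..}"
    by (auto simp: d_l1_def)
  have "(\<lambda>k. cmod (a k * x k)) summable_on {1..}" if x: "x \<in> int_bv" for x
  proof -
    obtain M where M: "\<And>n. cmod (of_nat n * x n) \<le> M"
      using int_bv_bounded[OF x] by blast
    show ?thesis
    proof (rule summable_on_comparison_test)
      show "(\<lambda>k. cmod (inverse (of_nat k) * a k) * M) summable_on {1..}"
        using a(2) by (rule summable_on_cmult_left)
      fix k :: nat assume "k \<in> {1..}"
      \<comment> \<open>Inserting \<open>k / k\<close>, possible since \<open>k \<ge> 1\<close>,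
        splits the term into a summable factor and one bounded by \<open>M\<close>.\<close>
      then have "a k * x k = (inverse (of_nat k) * a k) * (of_nat k * x k)"
        by simp
      then show "cmod (a k * x k) \<le> cmod (inverse (of_nat k) * a k) * M"
        by (metis M norm_mult mult_left_mono norm_ge_zero)
    qed simp
  qed
  with a(1) show "a \<in> alpha_dual int_bv"
    by (auto simp: alpha_dual_def)
qed

end
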